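(* Let $V$ be an $n$-dimensional Archimedean directed partially ordered vector space with positive cone $V_p$. Then the following statements are equivalent. (a) There exists a basis $\{x_1,\ldots,x_n\}$ of $V$ such that $V_p=\mathrm{pos}\{x_1,\ldots,x_n\}$. (b) $V$ is a vector lattice. (c) $V$ has the Riesz decomposition property. (d) $V$ is a pervasive pre-Riesz space. (e) $V$ is a weakly pervasive pre-Riesz space.
   Context: A partially ordered vector space is a real vector space $V$ with a partial order $\leq$ such that $u\leq v$ implies $u+w\leq v+w$ and $au\leq av$ for all $u,v,w\in V$ and real $a\geq 0$. Its positive cone is $V_p=\{x\in V: x\geq 0\}$. For $A\subseteq V$, $A^U$ denotes the set of upper bounds of $A$. $V$ is directed if any two elements have a common upper bound (equivalently, $V_p$ is generating). $V$ is Archimedean if $nx\leq y$ for all $n\in\mathbb{N}$ implies $x\leq 0$. $V$ is a vector lattice if $\sup\{x,y\}$ and $\inf\{x,y\}$ exist for all $x,y\in V$. $\mathrm{pos}\{x_1,\ldots,x_n\}$ is the set of all linear combinations $\sum_i c_ix_i$ with all $c_i\geq 0$. The Riesz decomposition property: whenever $x,y\in V_p$ and $0\leq z\leq x+y$, there exist $z_1,z_2$ with $z=z_1+z_2$, $0\leq z_1\leq x$, $0\leq z_2\leq y$. $V$ is a pre-Riesz space if for all $x,y,z\in V$ the inclusion $\{x+z,y+z\}^U\subseteq\{x,y\}^U$ implies $z\geq 0$. A pre-Riesz space $V$ is pervasive if for every $x\in V$ with $x\nleq 0$ there exists $y\in V_p\setminus\{0\}$ such that every positive upper bound of $x$ is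 also an upper bound of $y$. Elements $x,y\in V$ are disjoint if the sets $\{x+y,-(x+y)\}$ and $\{x-y,y-x\}$ have the same nonempty sets of upper bounds. Elements $x,y\in V_p$ are $D$-disjoint if $[0,x]\cap[0,y]=\{0\}$, where $[0,x]=\{w\in V:0\leq w\leq x\}$. A pre-Riesz space $V$ is weakly pervasive if any two $D$-disjoint elements of $V_p$ are disjoint. *)

theory Defs
  imports "HOL-Analysis.Analysis" "HOL-Library.Lub_Glb"
begin

text \<open>
  A partially ordered vector space is a type of class \<^class>\<open>ordered_real_vector\<close>, and the set
  of upper bounds of \<open>A\<close> is \<open>ubs UNIV A\<close>. Properties of the whole space take the type as an
  \<open>itself\<close> argument.
\<close>

definition positive_cone :: "'a::ordered_real_vector set" where
  "positive_cone = {x. 0 \<le> x}"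

abbreviation upper_bounds :: "'a::ord set \<Rightarrow> 'a set" where
  "upper_bounds A \<equiv> ubs UNIV A"

text \<open>Meant for finite \<open>S\<close> only: a sum over an infinite set is \<open>0\<close> by convention.\<close>
definition pos :: "'a::real_vector set \<Rightarrow> 'a set" where
  "pos S = {\<Sum>x\<in>S. c x *\<^sub>R x | c. \<forall>x\<in>S. 0 \<le> c x}"

text \<open>Finiteness is explicit because the cardinality of an infinite set is \<open>0\<close>.\<close>
definition is_basis_of_size :: "nat \<Rightarrow> 'a::real_vector set \<Rightarrow> bool" where
  "is_basis_of_size n B \<longleftrightarrow> finite B \<and> card B = n \<and> independent B \<and> span B = UNIV"

definition n_dimensional :: "nat \<Rightarrow> 'a::real_vector itself \<Rightarrow> bool" where
  "n_dimensional n _ \<longleftrightarrow> (\<exists>B::'a set. is_basis_of_size n B)"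

definition directed_space :: "'a::ordered_real_vector itself \<Rightarrow> bool" where
  "directed_space _ \<longleftrightarrow> (\<forall>x y::'a. upper_bounds {x, y} \<noteq> {})"

definition archimedean_space :: "'a::ordered_real_vector itself \<Rightarrow> bool" where
  "archimedean_space _ \<longleftrightarrow> (\<forall>x y::'a. (\<forall>n::nat. real n *\<^sub>R x \<le> y) \<longrightarrow> x \<le> 0)"

definition vector_lattice :: "'a::ordered_real_vector itself \<Rightarrow> bool" where
  "vector_lattice _ \<longleftrightarrow>
    (\<forall>x y::'a. (\<exists>s. isLub UNIV {x, y} s) \<and> (\<exists>i. isGlb UNIV {x, y} i))"

definition riesz_decomposition :: "'a::ordered_real_vector itself \<Rightarrow> bool" where
  "riesz_decomposition _ \<longleftrightarrow>
    (\<forall>x\<in>positive_cone. \<forall>y\<in>positive_cone. \<forall>z::'a. 0 \<le> z \<and> z \<le> x + y \<longrightarrow>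
      (\<exists>z1 z2. z = z1 + z2 \<and> 0 \<le> z1 \<and> z1 \<le> x \<and> 0 \<le> z2 \<and> z2 \<le> y))"

definition pre_riesz :: "'a::ordered_real_vector itself \<Rightarrow> bool" where
  "pre_riesz _ \<longleftrightarrow>
    (\<forall>x y z::'a. upper_bounds {x + z, y + z} \<subseteq> upper_bounds {x, y} \<longrightarrow> 0 \<le> z)"

definition pervasive_space :: "'a::ordered_real_vector itself \<Rightarrow> bool" where
  "pervasive_space _ \<longleftrightarrow>
    (\<forall>x::'a. \<not> x \<le> 0 \<longrightarrow>
      (\<exists>y\<in>positive_cone - {0}. \<forall>u\<in>positive_cone. x \<le> u \<longrightarrow> y \<le> u))"

text \<open>
  The nonemptiness requirement is automatic in a directed space.
\<close>
definition disjoint_elements :: "'a::ordered_real_vector \<Rightarrow> 'a \<Rightarrow> bool" where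
  "disjoint_elements x y \<longleftrightarrow>
    upper_bounds {x + y, - (x + y)} = upper_bounds {x - y, y - x} \<and>
    upper_bounds {x + y, - (x + y)} \<noteq> {}"

definition D_disjoint :: "'a::ordered_real_vector \<Rightarrow> 'a \<Rightarrow> bool" where
  "D_disjoint x y \<longleftrightarrow> {0..x} \<inter> {0..y} = {0}"

definition weakly_pervasive_space :: "'a::ordered_real_vector itself \<Rightarrow> bool" where
  "weakly_pervasive_space _ \<longleftrightarrow>
    (\<forall>x\<in>positive_cone. \<forall>y\<in>positive_cone. D_disjoint x (y::'a) \<longrightarrow> disjoint_elements x y)"

end

theory Submission
  imports Defs
begin

text \<open>
  Let (a) to (e) stand for: cone of a basis, vector lattice, Riesz decomposition, pervasive, weakly
  pervasive. The implications (a) to (b) to (c) to (e) and (a) to (d) to (e) are short, and the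
  pre-Riesz property holds throughout. The substance is (e) to (a), for which the proof combines
  order theory with linear algebra.

  A positive element \<open>e \<noteq> 0\<close> is extremal if its order interval lies on the line through \<open>e\<close>.
  In a finite-dimensional Archimedean space every positive element is a finite sum of extremal ones
  (\<open>positive_extremal_induct\<close>). The reason is a descent on the dimension of the face generated by
  \<open>x\<close>: subtracting from \<open>x\<close> the largest possible multiple of a vector of that face, which exists
  by the Archimedean property, leaves a vector that generates a face of smaller dimension. In a
  directed space the extremal elements therefore span, so some basis \<open>B\<close> consists of extremal
  elements.

  It remains to see that an extremal \<open>e\<close> is always a multiple of some member of \<open>B\<close>. Otherwise \<open>e\<close> is
  D-disjoint from all positive multiples of all members of \<open>B\<close>, because two extremal elements on
  different rays are D-disjoint. Weak pervasiveness turns this into disjointness, and, the space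
  being directed, disjointness of positive \<open>x\<close> and \<open>y\<close> says that \<open>x + y\<close> is the supremum of \<open>x\<close> and \<open>y\<close>. In that form it is visibly
  additive in \<open>y\<close>, so \<open>e\<close> is disjoint from every combination of \<open>B\<close> with nonnegative coefficients. But
  some such combination \<open>w\<close> dominates \<open>e\<close>, as \<open>B\<close> spans; then \<open>w = sup {e, w} = e + w\<close>, which forces
  \<open>e = 0\<close> (\<open>zero_if_sup_is_sum_span\<close>).
\<close>

section \<open>Disjointness, Riesz decomposition and pervasiveness\<close>

lemma upper_bounds_pair_iff: "u \<in> upper_bounds {x, y} \<longleftrightarrow> x \<le> u \<and> y \<le> u"
  by (auto simp: ubs_def isUb_def setle_def)

text \<open>
  As \<open>x + y\<close> is an upper bound of nonnegative \<open>x\<close> and \<open>y\<close>, for such elements this says that \<open>x + y\<close> is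
  their supremum, or equivalently that their infimum is \<open>0\<close>.
\<close>
definition sup_is_sum :: "'a::ordered_real_vector \<Rightarrow> 'a \<Rightarrow> bool" where
  "sup_is_sum x y \<longleftrightarrow> (\<forall>u. x \<le> u \<and> y \<le> u \<longrightarrow> x + y \<le> u)"

lemma scaleR_half_double:
  fixes v :: "'a::real_vector"
  shows "(1/2) *\<^sub>R (v + v) = v"
  by (simp add: scaleR_2[symmetric])

lemma double_le_double_iff:
  fixes v w :: "'a::ordered_real_vector"
  shows "v + v \<le> w + w \<longleftrightarrow> v \<le> w"
proof
  assume "v + v \<le> w + w"
  then have "(1/2) *\<^sub>R (v + v) \<le> (1/2) *\<^sub>R (w + w)"
    by (intro scaleR_left_mono) auto
  then show "v \<le> w" by (simp only: scaleR_half_double)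
qed (simp add: add_mono)

text \<open>
  For positive \<open>x\<close> and \<open>y\<close> only one inclusion between the two sets of upper bounds has content: each
  upper bound of \<open>x - y\<close> and \<open>y - x\<close> must lie above \<open>x + y\<close>. The substitution \<open>v = (u + x + y) / 2\<close>
  matches these upper bounds \<open>u\<close> with the upper bounds \<open>v\<close> of \<open>x\<close> and \<open>y\<close>.
\<close>
lemma disjoint_elements_iff_sup_is_sum:
  fixes x y :: "'a::ordered_real_vector"
  assumes dir: "directed_space TYPE('a)" and x: "0 \<le> x" and y: "0 \<le> y"
  shows "disjoint_elements x y \<longleftrightarrow> sup_is_sum x y"
proof -
  have nonempty: "upper_bounds {x + y, - (x + y)} \<noteq> {}"
    using dir unfolding directed_space_def by blast
  have easy: "x - y \<le> u \<and> y - x \<le> u" if "x + y \<le> u" for u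
  proof -
    have "x - y \<le> x + y" "y - x \<le> x + y" using x y by (simp_all add: algebra_simps add_increasing add_increasing2)
    then show ?thesis using that by (meson order_trans)
  qed
  have neg: "- (x + y) \<le> u" if "x + y \<le> u" for u
  proof -
    have "- (x + y) \<le> 0" "0 \<le> x + y" using x y by (simp_all add: add_nonneg_nonneg neg_le_0_iff_le del: minus_add_distrib)
    then show ?thesis using that by (meson order_trans)
  qed
  have "disjoint_elements x y \<longleftrightarrow> (\<forall>u. x - y \<le> u \<and> y - x \<le> u \<longrightarrow> x + y \<le> u)"
    unfolding disjoint_elements_def set_eq_iff upper_bounds_pair_iff using nonempty easy neg by blast
  also have "\<dots> \<longleftrightarrow> sup_is_sum x y"
  proof (intro iffI allI impI; (unfold sup_is_sum_def)?; (intro allI impI)?)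
    fix u assume hyp: "\<forall>u. x - y \<le> u \<and> y - x \<le> u \<longrightarrow> x + y \<le> u" and u: "x \<le> u \<and> y \<le> u"
    have "x + x \<le> u + u" "y + y \<le> u + u" using u by (simp_all add: add_mono)
    then have "x - y \<le> u + u - (x + y)" "y - x \<le> u + u - (x + y)"
      by (simp_all add: algebra_simps)
    with hyp have "x + y \<le> u + u - (x + y)" by blast
    then have "(x + y) + (x + y) \<le> u + u" by (simp add: algebra_simps)
    then show "x + y \<le> u" by (simp only: double_le_double_iff)
  next
    fix u assume hyp: "\<forall>u. x \<le> u \<and> y \<le> u \<longrightarrow> x + y \<le> u" and u: "x - y \<le> u \<and> y - x \<le> u"
    define v where "v = (1/2) *\<^sub>R (u + x + y)"
    have vv: "v + v = u + x + y" by (simp add: v_def scaleR_left_distrib[symmetric])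
    have "x + x \<le> v + v" "y + y \<le> v + v" using u unfolding vv by (simp_all add: algebra_simps)
    then have "x + y \<le> v" using hyp unfolding double_le_double_iff by blast
    then have "(x + y) + (x + y) \<le> v + v" by (simp only: double_le_double_iff)
    then show "x + y \<le> u" unfolding vv by (simp add: algebra_simps)
  qed
  finally show ?thesis .
qed

text \<open>
  The inclusion that defines pre-Riesz spaces says that translation by \<open>z\<close> maps the upper bounds of
  \<open>{x, y}\<close> into themselves. Iterating it from one upper bound \<open>u\<close> gives \<open>x \<le> u + n *\<^sub>R z\<close> for all
  \<open>n\<close>, to which the Archimedean property applies.
\<close>
lemma pre_riesz_if_archimedean_directed:
  assumes arch: "archimedean_space TYPE('a::ordered_real_vector)" and dir: "directed_space TYPE('a)"
  shows "pre_riesz TYPE('a)"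
  unfolding pre_riesz_def
proof (intro allI impI)
  fix x y z :: 'a
  assume sub: "upper_bounds {x + z, y + z} \<subseteq> upper_bounds {x, y}"
  obtain u where u: "u \<in> upper_bounds {x, y}" using dir unfolding directed_space_def by blast
  have iter: "u + real n *\<^sub>R z \<in> upper_bounds {x, y}" for n
  proof (induction n)
    case (Suc n)
    then have "u + real n *\<^sub>R z + z \<in> upper_bounds {x + z, y + z}"
      by (simp add: upper_bounds_pair_iff add_right_mono)
    then show ?case using sub by (auto simp: algebra_simps)
  qed (use u in simp)
  have "real n *\<^sub>R (- z) \<le> u - x" for n
    using iter[of n] by (simp add: upper_bounds_pair_iff algebra_simps)
  with arch have "- z \<le> 0" unfolding archimedean_space_def by blast
  then show "0 \<le> z" by simp
qed

text \<open>The infimum of \<open>z\<close> and \<open>x\<close> serves as the part of \<open>z\<close> below \<open>x\<close>.\<close>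
lemma riesz_decomposition_if_vector_lattice:
  assumes "vector_lattice TYPE('a::ordered_real_vector)"
  shows "riesz_decomposition TYPE('a)"
  unfolding riesz_decomposition_def positive_cone_def
proof (intro ballI allI impI)
  fix x y z :: 'a
  assume "x \<in> {x. 0 \<le> x}" "y \<in> {x. 0 \<le> x}" and z: "0 \<le> z \<and> z \<le> x + y"
  then have x: "0 \<le> x" and y: "0 \<le> y" by auto
  obtain i where "isGlb UNIV {z, x} i" using assms unfolding vector_lattice_def by blast
  then have i: "i \<le> z" "i \<le> x" and greatest: "\<And>l. l \<le> z \<Longrightarrow> l \<le> x \<Longrightarrow> l \<le> i"
    by (auto simp: isGlb_def greatestP_def isLb_def setge_def setle_def)
  have "0 \<le> i" using greatest z x by blast
  moreover have "z - y \<le> i" using z y by (intro greatest) (simp_all add: diff_le_eq add.commute)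
  ultimately have "z = i + (z - i) \<and> 0 \<le> i \<and> i \<le> x \<and> 0 \<le> z - i \<and> z - i \<le> y"
    using i by (simp add: algebra_simps)
  then show "\<exists>z1 z2. z = z1 + z2 \<and> 0 \<le> z1 \<and> z1 \<le> x \<and> 0 \<le> z2 \<and> z2 \<le> y" by blast
qed

lemma D_disjointD:
  fixes z :: "'a::ordered_real_vector"
  assumes D: "D_disjoint x y" and z: "0 \<le> z" "z \<le> x" "z \<le> y"
  shows "z = 0"
proof -
  have "z \<in> {0..x} \<inter> {0..y}" using z by simp
  then show ?thesis using D unfolding D_disjoint_def by blast
qed

text \<open>
  An upper bound \<open>u\<close> of \<open>x\<close> and \<open>y\<close> splits as \<open>x + (u - x)\<close>. Decomposing \<open>y\<close> accordingly, the
  part below \<open>x\<close> vanishes by D-disjointness, so \<open>y \<le> u - x\<close>.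
\<close>
lemma weakly_pervasive_if_riesz_decomposition:
  assumes dir: "directed_space TYPE('a::ordered_real_vector)" and rdp: "riesz_decomposition TYPE('a)"
  shows "weakly_pervasive_space TYPE('a)"
  unfolding weakly_pervasive_space_def positive_cone_def
proof (intro ballI impI)
  fix x y :: 'a
  assume "x \<in> {x. 0 \<le> x}" "y \<in> {x. 0 \<le> x}" and D: "D_disjoint x y"
  then have x: "0 \<le> x" and y: "0 \<le> y" by auto
  have "sup_is_sum x y" unfolding sup_is_sum_def
  proof (intro allI impI)
    fix u assume u: "x \<le> u \<and> y \<le> u"
    then have "0 \<le> y \<and> y \<le> x + (u - x)" "0 \<le> u - x" using y by simp_all
    then obtain z1 z2 where z: "y = z1 + z2" "0 \<le> z1" "z1 \<le> x" "0 \<le> z2" "z2 \<le> u - x"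
      using rdp x unfolding riesz_decomposition_def positive_cone_def by blast
    then have "z1 \<le> y" by simp
    with D z have "z1 = 0" by (blast intro: D_disjointD)
    with z show "x + y \<le> u" by (simp add: algebra_simps)
  qed
  then show "disjoint_elements x y" by (simp add: disjoint_elements_iff_sup_is_sum[OF dir x y])
qed

text \<open>
  If an upper bound \<open>u\<close> of \<open>x\<close> and \<open>y\<close> is not above \<open>x + y\<close>, then pervasiveness applies to
  \<open>x + y - u\<close>. Both \<open>x\<close> and \<open>y\<close> are positive upper bounds of this element, so the positive \<open>v\<close> that
  it yields lies below both and contradicts D-disjointness.
\<close>
lemma weakly_pervasive_if_pervasive:
  assumes dir: "directed_space TYPE('a::ordered_real_vector)" and perv: "pervasive_space TYPE('a)"
  shows "weakly_pervasive_space TYPE('a)"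
  unfolding weakly_pervasive_space_def positive_cone_def
proof (intro ballI impI)
  fix x y :: 'a
  assume "x \<in> {x. 0 \<le> x}" "y \<in> {x. 0 \<le> x}" and D: "D_disjoint x y"
  then have x: "0 \<le> x" and y: "0 \<le> y" by auto
  have "sup_is_sum x y" unfolding sup_is_sum_def
  proof (intro allI impI, rule ccontr)
    fix u assume u: "x \<le> u \<and> y \<le> u" and "\<not> x + y \<le> u"
    then have "\<not> x + y - u \<le> 0" by (simp add: algebra_simps)
    then obtain v where v: "0 \<le> v" "v \<noteq> 0" and least: "\<And>w. 0 \<le> w \<Longrightarrow> x + y - u \<le> w \<Longrightarrow> v \<le> w"
      using perv unfolding pervasive_space_def positive_cone_def by blast
    have "v \<le> x" "v \<le> y" using least[OF x] least[OF y] u by (simp_all add: algebra_simps)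
    with D v show False by (blast dest: D_disjointD)
  qed
  then show "disjoint_elements x y" by (simp add: disjoint_elements_iff_sup_is_sum[OF dir x y])
qed

section \<open>Cones generated by a basis\<close>

lemma representation_lincomb:
  assumes "is_basis_of_size n B" "b \<in> B"
  shows "representation B (\<Sum>b\<in>B. c b *\<^sub>R b) b = c b"
proof -
  have fin: "finite B" and ind: "independent B" and span: "\<And>v. v \<in> span B"
    using assms by (auto simp: is_basis_of_size_def)
  show ?thesis
    unfolding representation_sum[OF ind span] representation_scale[OF ind span]
    using assms(2) fin by (simp add: representation_basis[OF ind] if_distrib sum.delta cong: sum.cong if_cong)
qed

text \<open>The order is the coordinatewise one, so lattice operations can be read off coordinates.\<close>
lemma le_iff_representation_le:
  fixes x y :: "'a::ordered_real_vector"
  assumes basis: "is_basis_of_size n B" and cone: "positive_cone = pos B"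
  shows "x \<le> y \<longleftrightarrow> (\<forall>b\<in>B. representation B x b \<le> representation B y b)"
proof -
  have fin: "finite B" and ind: "independent B" and span: "\<And>v. v \<in> span B"
    using basis by (auto simp: is_basis_of_size_def)
  have "x \<le> y \<longleftrightarrow> y - x \<in> pos B" by (simp flip: cone add: positive_cone_def)
  also have "\<dots> \<longleftrightarrow> (\<forall>b\<in>B. 0 \<le> representation B (y - x) b)"
  proof
    assume "y - x \<in> pos B"
    then obtain c where c: "y - x = (\<Sum>b\<in>B. c b *\<^sub>R b)" "\<forall>b\<in>B. 0 \<le> c b"
      by (auto simp: pos_def)
    then show "\<forall>b\<in>B. 0 \<le> representation B (y - x) b"
      by (simp add: representation_lincomb[OF basis])
  next
    assume "\<forall>b\<in>B. 0 \<le> representation B (y - x) b"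
    moreover have "y - x = (\<Sum>b\<in>B. representation B (y - x) b *\<^sub>R b)"
      by (simp add: sum_representation_eq[OF ind span fin])
    ultimately show "y - x \<in> pos B" unfolding pos_def by blast
  qed
  also have "\<dots> \<longleftrightarrow> (\<forall>b\<in>B. representation B x b \<le> representation B y b)"
    by (simp add: representation_diff[OF ind span span])
  finally show ?thesis .
qed

lemma vector_lattice_if_cone_basis:
  fixes B :: "'a::ordered_real_vector set"
  assumes basis: "is_basis_of_size n B" and cone: "positive_cone = pos B"
  shows "vector_lattice TYPE('a)"
  unfolding vector_lattice_def
proof (intro allI conjI)
  fix x y :: 'a
  note le = le_iff_representation_le[OF basis cone] and rep = representation_lincomb[OF basis]
  have "isLub UNIV {x, y} (\<Sum>b\<in>B. max (representation B x b) (representation B y b) *\<^sub>R b)"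
    by (auto simp: isLub_def leastP_def isUb_def setle_def setge_def le rep)
  then show "\<exists>s. isLub UNIV {x, y} s" ..
  have "isGlb UNIV {x, y} (\<Sum>b\<in>B. min (representation B x b) (representation B y b) *\<^sub>R b)"
    by (auto simp: isGlb_def greatestP_def isLb_def setle_def setge_def le rep)
  then show "\<exists>i. isGlb UNIV {x, y} i" ..
qed

text \<open>
  The witness keeps one strictly positive coordinate of \<open>x\<close> and is \<open>0\<close> in all others, where it is
  dominated by a positive upper bound of \<open>x\<close> because that bound is nonnegative.
\<close>
lemma pervasive_if_cone_basis:
  fixes B :: "'a::ordered_real_vector set"
  assumes basis: "is_basis_of_size n B" and cone: "positive_cone = pos B"
  shows "pervasive_space TYPE('a)"
  unfolding pervasive_space_def positive_cone_def
proof (intro allI impI)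
  fix x :: 'a
  note le = le_iff_representation_le[OF basis cone]
  have ind: "independent B" and span: "\<And>v. v \<in> span B"
    using basis by (auto simp: is_basis_of_size_def)
  assume "\<not> x \<le> 0"
  then obtain b where b: "b \<in> B" and pos: "0 < representation B x b"
    by (auto simp: le representation_zero not_le)
  define y where "y = representation B x b *\<^sub>R b"
  have rep_y: "representation B y c = (if c = b then representation B x b else 0)" for c
    using b by (simp add: y_def representation_scale[OF ind span] representation_basis[OF ind])
  have "b \<noteq> 0" using ind b dependent_zero by blast
  then have "y \<noteq> 0" using pos by (simp add: y_def)
  moreover have "0 \<le> y" using pos by (simp add: le rep_y representation_zero)
  moreover have "y \<le> u" if "0 \<le> u" "x \<le> u" for u
    using that b unfolding le by (simp add: rep_y representation_zero)
  ultimately show "\<exists>y\<in>{x. 0 \<le> x} - {0}. \<forall>u\<in>{x. 0 \<le> x}. x \<le> u \<longrightarrow> y \<le> u" by blast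
qed

section \<open>Extremal decomposition of positive elements\<close>

text \<open>
  Replacing the coefficients of a linear combination of positive elements by their absolute values
  can only increase it. The set \<open>W\<close> stands for whatever property of the dominating element is
  wanted.
\<close>
lemma span_dominated:
  fixes S W :: "'a::ordered_real_vector set"
  assumes zero: "0 \<in> W" and add: "\<And>v w. v \<in> W \<Longrightarrow> w \<in> W \<Longrightarrow> v + w \<in> W"
    and nonneg: "\<And>b. b \<in> S \<Longrightarrow> 0 \<le> b"
    and scale: "\<And>b t. b \<in> S \<Longrightarrow> 0 \<le> t \<Longrightarrow> t *\<^sub>R b \<in> W"
    and v: "v \<in> span S"
  shows "\<exists>w\<in>W. v \<le> w"
  using v
proof (induction rule: span_induct_alt)
  case base
  show ?case using zero by blast
next
  case (step c b v)
  then obtain w where w: "w \<in> W" "v \<le> w" by blast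
  have "c *\<^sub>R b \<le> \<bar>c\<bar> *\<^sub>R b" using nonneg[OF step(1)] by (intro scaleR_right_mono) auto
  then have "c *\<^sub>R b + v \<le> \<bar>c\<bar> *\<^sub>R b + w" using w(2) by (rule add_mono)
  moreover have "\<bar>c\<bar> *\<^sub>R b + w \<in> W" using add scale[OF step(1)] w(1) by simp
  ultimately show ?case by blast
qed

definition face :: "'a::ordered_real_vector \<Rightarrow> 'a set" where
  "face x = {z. 0 \<le> z \<and> (\<exists>c\<ge>0. z \<le> c *\<^sub>R x)}"

lemma faceI: "0 \<le> z \<Longrightarrow> 0 \<le> c \<Longrightarrow> z \<le> c *\<^sub>R x \<Longrightarrow> z \<in> face x"
  unfolding face_def by blast

lemma dominated_in_face: "0 \<le> z \<Longrightarrow> z \<le> x \<Longrightarrow> z \<in> face x"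
  by (rule faceI[where c = 1]) auto

lemma face_mono:
  assumes "y \<in> face x"
  shows "face y \<subseteq> face x"
proof
  fix z assume "z \<in> face y"
  then obtain c where c: "0 \<le> z" "0 \<le> c" "z \<le> c *\<^sub>R y" by (auto simp: face_def)
  obtain d where d: "0 \<le> d" "y \<le> d *\<^sub>R x" using assms by (auto simp: face_def)
  have "z \<le> (c * d) *\<^sub>R x"
    using order_trans[OF c(3) scaleR_left_mono[OF d(2) c(2)]] by simp
  then show "z \<in> face x" using c d by (intro faceI[where c = "c * d"]) auto
qed

text \<open>
  Elements of the span are dominated by elements of the face, and the face contains every positive
  element below one of its members. So a face is recovered from its span, and the dimension of the
  span can tell a face from a proper subface.
\<close>
lemma span_face_positive:
  assumes "v \<in> span (face y)" "0 \<le> v"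
  shows "v \<in> face y"
proof -
  have "\<exists>w\<in>face y. v \<le> w"
  proof (rule span_dominated[OF _ _ _ _ assms(1)])
    show "0 \<in> face y" by (rule faceI[where c = 0]) auto
    show "v + w \<in> face y" if vw: "v \<in> face y" "w \<in> face y" for v w
    proof -
      obtain c d where "0 \<le> v" "0 \<le> c" "v \<le> c *\<^sub>R y" "0 \<le> w" "0 \<le> d" "w \<le> d *\<^sub>R y"
        using vw by (auto simp: face_def)
      then show ?thesis
        by (intro faceI[where c = "c + d"]) (auto simp: scaleR_left_distrib intro: add_mono)
    qed
    show "t *\<^sub>R b \<in> face y" if b: "b \<in> face y" "0 \<le> t" for b t
    proof -
      obtain c where "0 \<le> b" "0 \<le> c" "b \<le> c *\<^sub>R y" using b by (auto simp: face_def)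
      then show ?thesis using b(2) scaleR_left_mono[of b "c *\<^sub>R y" t]
        by (intro faceI[where c = "t * c"]) (auto intro: scaleR_nonneg_nonneg)
    qed
  qed (auto simp: face_def)
  then obtain w c where "v \<le> w" "0 \<le> c" "w \<le> c *\<^sub>R y" by (auto simp: face_def)
  then show ?thesis using assms(2) by (blast intro: faceI order_trans)
qed

lemma dim_strict_mono_span:
  fixes S T :: "'a::real_vector set"
  assumes "n_dimensional n TYPE('a)" "span S \<subset> span T"
  shows "dim S < dim T"
proof -
  obtain B :: "'a set" where B: "finite B" "independent B" "span B = UNIV"
    using assms(1) by (auto simp: n_dimensional_def is_basis_of_size_def)
  interpret fd: finite_dimensional_vector_space "scaleR :: real \<Rightarrow> 'a \<Rightarrow> 'a" B
    by unfold_locales (use B in \<open>simp_all add: dependent_raw_def span_raw_def algebra_simps\<close>)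
  show ?thesis using fd.dim_psubset assms(2) unfolding span_raw_def dim_raw_def by blast
qed

lemma dim_face_less:
  fixes x y :: "'a::ordered_real_vector"
  assumes "n_dimensional n TYPE('a)" "y \<in> face x" "a \<in> face x" "a \<notin> face y"
  shows "dim (face y) < dim (face x)"
proof (rule dim_strict_mono_span[OF assms(1)])
  have "a \<notin> span (face y)" using span_face_positive assms(3,4) by (auto simp: face_def)
  moreover have "a \<in> span (face x)" using assms(3) by (rule span_base)
  ultimately show "span (face y) \<subset> span (face x)"
    using span_mono[OF face_mono[OF assms(2)]] by blast
qed

text \<open>
  The number \<open>t\<close> is the supremum of all \<open>t\<close> with \<open>t *\<^sub>R e \<le> x\<close>. The Archimedean property is used
  twice: this set is bounded because \<open>e \<le> 0\<close> fails, and it contains its supremum because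
  \<open>k *\<^sub>R (t *\<^sub>R e - x) \<le> e\<close> for all natural \<open>k\<close>. By maximality no positive multiple of \<open>e\<close> lies
  below the remainder, which is what its face not containing \<open>e\<close> means.
\<close>
lemma archimedean_subtract_maximal:
  fixes e x :: "'a::ordered_real_vector"
  assumes arch: "archimedean_space TYPE('a)" and e: "0 \<le> e" "e \<noteq> 0" and x: "0 \<le> x"
  obtains t where "0 \<le> t" "t *\<^sub>R e \<le> x" "e \<notin> face (x - t *\<^sub>R e)"
proof -
  define S where "S = {t. t *\<^sub>R e \<le> x}"
  have "0 \<in> S" using x by (simp add: S_def)
  have "\<not> e \<le> 0" using e by auto
  then obtain n :: nat where n: "\<not> real n *\<^sub>R e \<le> x"
    using arch unfolding archimedean_space_def by blast
  have bound: "t \<le> real n" if "t \<in> S" for t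
  proof (rule ccontr)
    assume "\<not> t \<le> real n"
    then have "real n *\<^sub>R e \<le> t *\<^sub>R e" using e by (intro scaleR_right_mono) auto
    with that n show False unfolding S_def by auto
  qed
  then have bdd: "bdd_above S" by (rule bdd_aboveI)
  define t where "t = Sup S"
  have t0: "0 \<le> t" unfolding t_def using \<open>0 \<in> S\<close> bdd by (rule cSup_upper)
  have "real k *\<^sub>R (t *\<^sub>R e - x) \<le> e" for k :: nat
  proof (cases "k = 0")
    case False
    \<comment> \<open>An element of \<open>S\<close> within distance \<open>1 / k\<close> of \<open>t\<close> costs one copy of \<open>e\<close> after multiplication by \<open>k\<close>.\<close>
    have "t - 1 / real k < Sup S" using False by (simp add: t_def)
    then obtain s where s: "s \<in> S" "t - 1 / real k < s"
      using \<open>0 \<in> S\<close> bdd less_cSup_iff by blast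
    have "real k * t - 1 \<le> real k * s"
    proof -
      have "real k * (t - 1 / real k) \<le> real k * s" using s by (intro mult_left_mono) auto
      then show ?thesis using False by (simp add: algebra_simps)
    qed
    then have "(real k * t - 1) *\<^sub>R e \<le> (real k * s) *\<^sub>R e" using e by (intro scaleR_right_mono) auto
    also have "\<dots> \<le> real k *\<^sub>R x"
      using s(1) scaleR_left_mono[of "s *\<^sub>R e" x "real k"] by (simp add: S_def)
    finally show ?thesis by (simp add: algebra_simps)
  qed (use e in simp)
  then have "t *\<^sub>R e - x \<le> 0" using arch unfolding archimedean_space_def by blast
  then have te: "t *\<^sub>R e \<le> x" by simp
  have "e \<notin> face (x - t *\<^sub>R e)"
  proof
    assume "e \<in> face (x - t *\<^sub>R e)"
    then obtain c where c: "0 \<le> c" "e \<le> c *\<^sub>R (x - t *\<^sub>R e)" by (auto simp: face_def)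
    have "c \<noteq> 0" using c(2) \<open>\<not> e \<le> 0\<close> by auto
    then have "inverse c *\<^sub>R e \<le> x - t *\<^sub>R e"
      using c scaleR_left_mono[OF c(2), of "inverse c"] by simp
    then have "t + inverse c \<in> S" by (simp add: S_def algebra_simps)
    then have "t + inverse c \<le> t" unfolding t_def using bdd by (rule cSup_upper)
    then show False using c(1) \<open>c \<noteq> 0\<close> by simp
  qed
  with t0 te that show thesis by blast
qed

definition extremal :: "'a::ordered_real_vector \<Rightarrow> bool" where
  "extremal e \<longleftrightarrow> 0 \<le> e \<and> e \<noteq> 0 \<and> (\<forall>y. 0 \<le> y \<and> y \<le> e \<longrightarrow> (\<exists>c. y = c *\<^sub>R e))"

lemma extremal_scaleR:
  assumes e: "extremal e" and t: "0 < t"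
  shows "extremal (t *\<^sub>R e)"
  unfolding extremal_def
proof (intro conjI allI impI)
  fix y assume y: "0 \<le> y \<and> y \<le> t *\<^sub>R e"
  then have "inverse t *\<^sub>R y \<le> inverse t *\<^sub>R (t *\<^sub>R e)" using t by (intro scaleR_left_mono) auto
  then have "inverse t *\<^sub>R y \<le> e" "0 \<le> inverse t *\<^sub>R y"
    using t y by (auto intro: scaleR_nonneg_nonneg)
  then obtain c where "inverse t *\<^sub>R y = c *\<^sub>R e" using e unfolding extremal_def by blast
  then have "t *\<^sub>R (inverse t *\<^sub>R y) = t *\<^sub>R (c *\<^sub>R e)" by simp
  then have "y = c *\<^sub>R (t *\<^sub>R e)" using t by (simp add: mult.commute)
  then show "\<exists>c. y = c *\<^sub>R t *\<^sub>R e" ..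
qed (use assms in \<open>auto simp: extremal_def intro: scaleR_nonneg_nonneg\<close>)

text \<open>
  If \<open>x\<close> is not extremal, some \<open>y\<close> between \<open>0\<close> and \<open>x\<close> is not a multiple of \<open>x\<close>. Removing from \<open>y\<close> the
  largest possible multiple of \<open>x\<close> leaves a nonzero element below \<open>x\<close> whose face misses \<open>x\<close> and has
  therefore smaller dimension than that of \<open>x\<close>.
\<close>
lemma extremal_below_positive:
  fixes x :: "'a::ordered_real_vector"
  assumes fd: "n_dimensional n TYPE('a)" and arch: "archimedean_space TYPE('a)"
    and "0 \<le> x" "x \<noteq> 0"
  shows "\<exists>e\<le>x. extremal e"
  using assms(3,4)
proof (induction "dim (face x)" arbitrary: x rule: less_induct)
  case less
  show ?case
  proof (cases "extremal x")
    case False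
    then obtain y where y: "0 \<le> y" "y \<le> x" "\<And>c. y \<noteq> c *\<^sub>R x"
      using less.prems unfolding extremal_def by blast
    obtain t where t: "0 \<le> t" "t *\<^sub>R x \<le> y" "x \<notin> face (y - t *\<^sub>R x)"
      using archimedean_subtract_maximal[OF arch less.prems y(1)] by blast
    define z where "z = y - t *\<^sub>R x"
    have "0 \<le> t *\<^sub>R x" using t less.prems by (intro scaleR_nonneg_nonneg) auto
    then have z: "0 \<le> z" "z \<noteq> 0" "z \<le> x"
      using t(2) y by (auto simp: z_def diff_le_eq intro: add_increasing2)
    have "dim (face z) < dim (face x)"
      using t(3) z less.prems by (intro dim_face_less[OF fd, where a = x]) (auto simp: z_def intro: dominated_in_face)
    with less.hyps z obtain e where "e \<le> z" "extremal e" by blast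
    with z(3) show ?thesis by (blast intro: order_trans)
  qed auto
qed

text \<open>
  Every positive element is a finite sum of extremal elements, stated as an induction rule: a
  maximal multiple of an extremal element below \<open>x\<close> is split off, and the remainder generates a
  face of smaller dimension.
\<close>
lemma positive_extremal_induct:
  fixes x :: "'a::ordered_real_vector"
  assumes fd: "n_dimensional n TYPE('a)" and arch: "archimedean_space TYPE('a)"
    and x: "0 \<le> x"
    and zero: "P 0" and add: "\<And>x e. P x \<Longrightarrow> extremal e \<Longrightarrow> P (x + e)"
  shows "P x"
  using x
proof (induction "dim (face x)" arbitrary: x rule: less_induct)
  case less
  show ?case
  proof (cases "x = 0")
    case False
    then obtain e where e: "e \<le> x" "extremal e"
      using extremal_below_positive[OF fd arch less.prems] by blast
    then have e0: "0 \<le> e" "e \<noteq> 0" by (auto simp: extremal_def)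
    obtain t where t: "0 \<le> t" "t *\<^sub>R e \<le> x" "e \<notin> face (x - t *\<^sub>R e)"
      using archimedean_subtract_maximal[OF arch e0 less.prems] by blast
    define y where "y = x - t *\<^sub>R e"
    have "0 \<le> t *\<^sub>R e" using t(1) e0(1) by (rule scaleR_nonneg_nonneg)
    then have y: "0 \<le> y" "y \<le> x" using t(2) by (auto simp: y_def)
    have "dim (face y) < dim (face x)"
      using y e e0 t(3) by (intro dim_face_less[OF fd, where a = e]) (auto simp: y_def intro: dominated_in_face)
    with less.hyps y have Py: "P y" by blast
    have "t \<noteq> 0" using t(3) e e0 by (auto intro: dominated_in_face)
    then have "extremal (t *\<^sub>R e)" using t(1) e(2) by (intro extremal_scaleR) auto
    with add[OF Py, of "t *\<^sub>R e"] show ?thesis by (simp add: y_def)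
  qed (use zero in simp)
qed

section \<open>Weakly pervasive spaces\<close>

text \<open>
  An upper bound \<open>u\<close> of \<open>x\<close> and \<open>y + z\<close> is above \<open>x + y\<close>, hence \<open>u - y\<close> is again an upper bound of \<open>x\<close>,
  and of \<open>z\<close>.
\<close>
lemma sup_is_sum_add:
  assumes "sup_is_sum x y" "sup_is_sum x z" "0 \<le> y" "0 \<le> z"
  shows "sup_is_sum x (y + z)"
  unfolding sup_is_sum_def
proof (intro allI impI)
  fix u assume u: "x \<le> u \<and> y + z \<le> u"
  then have "y \<le> u" using assms(4) by (meson add_increasing2 order_refl order_trans)
  then have "x + y \<le> u" using u assms(1) by (simp add: sup_is_sum_def)
  then have "x \<le> u - y" "z \<le> u - y" using u by (simp_all add: algebra_simps)
  then have "x + z \<le> u - y" using assms(2) by (simp add: sup_is_sum_def)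
  then show "x + (y + z) \<le> u" by (simp add: algebra_simps)
qed

text \<open>
  Membership in the span gives a nonnegative combination \<open>w\<close> of \<open>S\<close> above \<open>e\<close>. Then \<open>w\<close> is an upper
  bound of \<open>e\<close> and \<open>w\<close>, so that \<open>e + w \<le> w\<close>.
\<close>
lemma zero_if_sup_is_sum_span:
  fixes e :: "'a::ordered_real_vector"
  assumes e: "0 \<le> e" "e \<in> span S" and S: "\<And>b. b \<in> S \<Longrightarrow> 0 \<le> b"
    and disj: "\<And>b t. b \<in> S \<Longrightarrow> 0 \<le> t \<Longrightarrow> sup_is_sum e (t *\<^sub>R b)"
  shows "e = 0"
proof -
  have "\<exists>w\<in>{w. 0 \<le> w \<and> sup_is_sum e w}. e \<le> w"
  proof (rule span_dominated[OF _ _ _ _ e(2)])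
    show "0 \<in> {w. 0 \<le> w \<and> sup_is_sum e w}" by (simp add: sup_is_sum_def)
  qed (use S disj in \<open>auto intro: sup_is_sum_add scaleR_nonneg_nonneg\<close>)
  then obtain w where "sup_is_sum e w" "e \<le> w" by blast
  then have "e + w \<le> w" unfolding sup_is_sum_def by blast
  then show ?thesis using e(1) by simp
qed

lemma D_disjoint_extremal:
  assumes e: "extremal e" and f: "extremal f" and not_prop: "\<And>c. e \<noteq> c *\<^sub>R f"
  shows "D_disjoint e f"
proof -
  have "z = 0" if z: "0 \<le> z" "z \<le> e" "z \<le> f" for z
  proof (rule ccontr)
    assume "z \<noteq> 0"
    obtain c d where c: "z = c *\<^sub>R e" and d: "z = d *\<^sub>R f"
      using e f z unfolding extremal_def by blast
    have "c \<noteq> 0" using c \<open>z \<noteq> 0\<close> by auto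
    then have "e = inverse c *\<^sub>R z" by (simp add: c)
    then have "e = (inverse c * d) *\<^sub>R f" by (simp add: d)
    with not_prop show False by blast
  qed
  then show ?thesis using e f by (auto simp: D_disjoint_def extremal_def)
qed

text \<open>
  Any maximal linearly independent set of extremal elements works: it is a basis because the
  extremal elements span, and it meets every extremal ray by the two preceding lemmas.
\<close>
lemma cone_basis_if_weakly_pervasive:
  assumes fd: "n_dimensional n TYPE('a::ordered_real_vector)" and arch: "archimedean_space TYPE('a)"
    and dir: "directed_space TYPE('a)" and wp: "weakly_pervasive_space TYPE('a)"
  shows "\<exists>B::'a set. is_basis_of_size n B \<and> positive_cone = pos B"
proof -
  obtain B :: "'a set" where B: "B \<subseteq> Collect extremal" "independent B" "Collect extremal \<subseteq> span B"
    using maximal_independent_subset by blast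
  have extB: "extremal b" and posB: "0 \<le> b" if "b \<in> B" for b
    using that B(1) by (auto simp: extremal_def)
  have positive_in_span: "x \<in> span B" if "0 \<le> x" for x
    using positive_extremal_induct[OF fd arch that, of "\<lambda>x. x \<in> span B"] B(3)
    by (auto intro: span_zero span_add)
  have "v \<in> span B" for v
  proof -
    obtain u where "v \<le> u" "0 \<le> u"
      using dir unfolding directed_space_def by (metis all_not_in_conv upper_bounds_pair_iff)
    then have "u - (u - v) \<in> span B" by (intro span_diff positive_in_span) auto
    then show ?thesis by simp
  qed
  then have spanB: "span B = UNIV" by blast
  obtain A :: "'a set" where A: "finite A" "card A = n" "independent A" "span A = UNIV"
    using fd by (auto simp: n_dimensional_def is_basis_of_size_def)
  have finB: "finite B" using independent_span_bound[OF A(1) B(2)] A(4) by auto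
  have "card B = n"
    using dim_eq_card[of B UNIV] dim_eq_card[of A UNIV] A B(2) spanB by simp
  then have basis: "is_basis_of_size n B"
    using finB B(2) spanB by (simp add: is_basis_of_size_def)
  have multiple: "\<exists>b\<in>B. \<exists>c. e = c *\<^sub>R b" if e: "extremal e" for e :: 'a
  proof (rule ccontr)
    assume not: "\<not> ?thesis"
    have "e = 0"
    proof (rule zero_if_sup_is_sum_span)
      show "0 \<le> e" using e by (simp add: extremal_def)
      show "sup_is_sum e (t *\<^sub>R b)" if b: "b \<in> B" "0 \<le> t" for b t
      proof (cases "t = 0")
        case True
        then show ?thesis by (simp add: sup_is_sum_def)
      next
        case False
        then have tb: "extremal (t *\<^sub>R b)" using b extB by (simp add: extremal_scaleR)
        have "e \<noteq> c *\<^sub>R t *\<^sub>R b" for c using not b(1) by auto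
        with e tb have "D_disjoint e (t *\<^sub>R b)" by (rule D_disjoint_extremal)
        moreover have "0 \<le> e" "0 \<le> t *\<^sub>R b" using e tb by (auto simp: extremal_def)
        ultimately show ?thesis
          using wp disjoint_elements_iff_sup_is_sum[OF dir]
          by (auto simp: weakly_pervasive_space_def positive_cone_def)
      qed
    qed (use spanB posB in auto)
    with e show False by (simp add: extremal_def)
  qed
  have "x \<in> pos B" if "0 \<le> x" for x
  proof (rule positive_extremal_induct[OF fd arch that])
    show "0 \<in> pos B" by (auto simp: pos_def intro!: exI[of _ "\<lambda>_. 0"])
    fix x e :: 'a assume "x \<in> pos B" and e: "extremal e"
    then obtain a where a: "x = (\<Sum>b\<in>B. a b *\<^sub>R b)" "\<forall>b\<in>B. 0 \<le> a b" by (auto simp: pos_def)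
    obtain b c where b: "b \<in> B" and c: "e = c *\<^sub>R b" using multiple[OF e] by blast
    have "0 \<le> c"
    proof (rule ccontr)
      assume "\<not> 0 \<le> c"
      then have "e \<le> 0" using posB[OF b] by (simp add: c scaleR_nonpos_nonneg)
      with e show False by (auto simp: extremal_def)
    qed
    have "x + e = (\<Sum>b'\<in>B. (a b' + (if b' = b then c else 0)) *\<^sub>R b')"
      using b finB by (simp add: a c scaleR_left_distrib sum.distrib if_distrib[of "\<lambda>t. t *\<^sub>R _"] cong: if_cong)
    with a(2) \<open>0 \<le> c\<close> show "x + e \<in> pos B"
      unfolding pos_def by (intro CollectI exI[of _ "\<lambda>b'. a b' + (if b' = b then c else 0)"]) simp
  qed
  moreover have "0 \<le> x" if "x \<in> pos B" for x
    using that posB by (auto simp: pos_def intro!: sum_nonneg scaleR_nonneg_nonneg)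
  ultimately have "positive_cone = pos B" by (auto simp: positive_cone_def)
  with basis show ?thesis by blast
qed

theorem corollary4p4:
  fixes n :: nat
  assumes "n_dimensional n TYPE('a::ordered_real_vector)"
    and "archimedean_space TYPE('a)"
    and "directed_space TYPE('a)"
  shows "((\<exists>B::'a set. is_basis_of_size n B \<and> positive_cone = pos B) \<longleftrightarrow> vector_lattice TYPE('a)) \<and>
         (vector_lattice TYPE('a) \<longleftrightarrow> riesz_decomposition TYPE('a)) \<and>
         (riesz_decomposition TYPE('a) \<longleftrightarrow> pre_riesz TYPE('a) \<and> pervasive_space TYPE('a)) \<and>
         (pre_riesz TYPE('a) \<and> pervasive_space TYPE('a) \<longleftrightarrow> pre_riesz TYPE('a) \<and> weakly_pervasive_space TYPE('a))"
proof -
  have "pre_riesz TYPE('a)" using assms(2,3) by (rule pre_riesz_if_archimedean_directed)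
  moreover have "vector_lattice TYPE('a)" "pervasive_space TYPE('a)"
    if "\<exists>B::'a set. is_basis_of_size n B \<and> positive_cone = pos B"
    using that vector_lattice_if_cone_basis pervasive_if_cone_basis by blast+
  moreover note riesz_decomposition_if_vector_lattice[where 'a = 'a]
    weakly_pervasive_if_riesz_decomposition[OF assms(3)] weakly_pervasive_if_pervasive[OF assms(3)]
    cone_basis_if_weakly_pervasive[OF assms]
  ultimately show ?thesis by blast
qed

end
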